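(* Consider the $Q^2$ spectral element scheme for $-\Delta u=f$ with Dirichlet boundary conditions on a (possibly non-uniform) rectangular mesh of $[0,1]\times[0,1]$, with matrix $\bar L_h$ as given explicitly in the context, where $h^x_1,\dots,h^x_m$ are the half-widths of the mesh columns and $h^y_1,\dots,h^y_m$ the half-heights of the mesh rows. Suppose that for all $a,b\in\{2,\dots,m\}$ (i.e. for every group of four mesh cells sharing an interior vertex) the following hold: $$h^x_a h^x_{a-1}\ \ge\ \tfrac{7}{12}\max\{(h^y_b)^2,(h^y_{b-1})^2\},\qquad h^y_b h^y_{b-1}\ \ge\ \tfrac{7}{12}\max\{(h^x_a)^2,(h^x_{a-1})^2\},$$ $$\min\{h^x_a,h^x_{a-1}\}\ \ge\ \sqrt{\tfrac13}\,\max\{h^y_b,h^y_{b-1}\},\qquad \min\{h^y_b,h^y_{b-1}\}\ \ge\ \sqrt{\tfrac13}\,\max\{h^x_a,h^x_{a-1}\}.$$ Then $\bar L_h$ is monotone, i.e. $\bar L_h$ is invertible and $\bar L_h^{-1}\ge 0$ entrywise; and thus the scheme satisfies the discrete maximum principle: for every grid function $\bar{\mathbf u}=(u_{i,j})_{0\le i,j\le n+1}$, $$(\bar L_h\bar{\mathbf u})_{i,j}\le 0 \text{ for all } 1\le i,j\le n\ \Longrightarrow\ \max_{1\le i,j\le n}u_{i,j}\ \le\ \max\Big\{0,\ \max_{(x_i,y_j)\in\partial\Omega}u_{i,j}\Big\}.$$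
   Context: Mesh and grid. Let $\Omega=(0,1)\times(0,1)$, $m\ge1$ an integer and $n=2m-1$ (so $n$ is odd). The square is divided into $m\times m$ rectangular cells by a tensor-product mesh. Column $a\in\{1,\dots,m\}$ has width $2h^x_a>0$ and row $b\in\{1,\dots,m\}$ has height $2h^y_b>0$, with $\sum_a 2h^x_a=\sum_b 2h^y_b=1$. The grid points are $(x_i,y_j)$, $0\le i,j\le n+1$, where $0=x_0<x_1<\dots<x_{n+1}=1$, column $a$ is $[x_{2a-2},x_{2a}]$ and $x_{2a-1}$ is its midpoint; similarly row $b$ is $[y_{2b-2},y_{2b}]$ with midpoint $y_{2b-1}$. (These are the $3\times3$ Gauss-Lobatto points of all the cells.) Boundary points are those with $i\in\{0,n+1\}$ or $j\in\{0,n+1\}$; the others are interior points. Matrix. $\bar L_h$ is the matrix of the linear map on grid functions $\bar{\mathbf u}=(u_{i,j})_{0\le i,j\le n+1}$ (viewed as vectors in $\mathbb R^{(n+2)^2}$) defined below. Inside each formula, abbreviate as follows: if $i$ is odd, $h_a$ is the half-width of the column with midpoint $x_i$; if $i$ is even (interior), $h_{a-1}$ and $h_a$ are the half-widths of the columns immediately to the left and to the right of $x_i$; if $j$ is odd, $h_b$ is the half-height of the row with midpoint $y_j$; if $j$ is even (interior), $h_{b-1}$ and $h_b$ are the half-heights of the rows immediately below and above $y_j$. - Boundary point: $(\bar L_h\bar{\mathbf u})_{i,j}=u_{i,j}$. - Cell center (interior, $i$ odd, $j$ odd): $$(\bar L_h\bar{\mathbf u})_{i,j}=\frac{2h_a^2+2h_b^2}{h_a^2h_b^2}u_{i,j}-\frac{u_{i+1,j}+u_{i-1,j}}{h_a^2}-\frac{u_{i,j+1}+u_{i,j-1}}{h_b^2}.$$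 - Center of an interior edge parallel to the $y$-axis (interior, $i$ even, $j$ odd): $$(\bar L_h\bar{\mathbf u})_{i,j}=\frac{7h_b^2+4h_ah_{a-1}}{2h_ah_{a-1}h_b^2}u_{i,j}-\frac{4u_{i+1,j}}{h_a(h_a+h_{a-1})}-\frac{4u_{i-1,j}}{h_{a-1}(h_a+h_{a-1})}-\frac{u_{i,j+1}+u_{i,j-1}}{h_b^2}+\frac{u_{i+2,j}}{2h_a(h_a+h_{a-1})}+\frac{u_{i-2,j}}{2h_{a-1}(h_a+h_{a-1})}.$$ - Center of an interior edge parallel to the $x$-axis (interior, $i$ odd, $j$ even): $$(\bar L_h\bar{\mathbf u})_{i,j}=\frac{7h_a^2+4h_bh_{b-1}}{2h_bh_{b-1}h_a^2}u_{i,j}-\frac{4u_{i,j+1}}{h_b(h_b+h_{b-1})}-\frac{4u_{i,j-1}}{h_{b-1}(h_b+h_{b-1})}-\frac{u_{i+1,j}+u_{i-1,j}}{h_a^2}+\frac{u_{i,j+2}}{2h_b(h_b+h_{b-1})}+\frac{u_{i,j-2}}{2h_{b-1}(h_b+h_{b-1})}.$$ - Interior knot (interior, $i$ even, $j$ even): $$(\bar L_h\bar{\mathbf u})_{i,j}=\frac{7h_ah_{a-1}+7h_bh_{b-1}}{2h_ah_{a-1}h_bh_{b-1}}u_{i,j}-\frac{4u_{i+1,j}}{h_a(h_a+h_{a-1})}-\frac{4u_{i-1,j}}{h_{a-1}(h_a+h_{a-1})}-\frac{4u_{i,j+1}}{h_b(h_b+h_{b-1})}-\frac{4u_{i,j-1}}{h_{b-1}(h_b+h_{b-1})}$$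 $$\qquad+\frac{u_{i+2,j}}{2h_a(h_a+h_{a-1})}+\frac{u_{i-2,j}}{2h_{a-1}(h_a+h_{a-1})}+\frac{u_{i,j+2}}{2h_b(h_b+h_{b-1})}+\frac{u_{i,j-2}}{2h_{b-1}(h_b+h_{b-1})}.$$ The scheme is $(\bar L_h\bar{\mathbf u})_{i,j}=f_{i,j}$ at interior points and $u_{i,j}=g_{i,j}$ at boundary points. All matrix inequalities are entrywise. *)

theory Defs
  imports Complex_Main "Jordan_Normal_Form.Matrix"
begin

text \<open>
  Grid functions are functions \<open>u :: nat \<Rightarrow> nat \<Rightarrow> real\<close> of which only the values \<open>u i j\<close> with
  \<open>i, j \<le> n + 1\<close> matter.  Half-widths \<open>hx\<close> and half-heights \<open>hy\<close> are indexed by the cells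
  \<open>1, \<dots>, m\<close>, where \<open>n = 2 * m - 1\<close>.
\<close>

definition rect_mesh :: "nat \<Rightarrow> (nat \<Rightarrow> real) \<Rightarrow> (nat \<Rightarrow> real) \<Rightarrow> bool" where
  "rect_mesh m hx hy \<longleftrightarrow> 1 \<le> m \<and>
     (\<forall>a\<in>{1..m}. 0 < hx a) \<and> (\<forall>b\<in>{1..m}. 0 < hy b) \<and>
     (\<Sum>a=1..m. 2 * hx a) = 1 \<and> (\<Sum>b=1..m. 2 * hy b) = 1"

definition interior_points :: "nat \<Rightarrow> (nat \<times> nat) set" where
  "interior_points n = {1..n} \<times> {1..n}"

definition boundary_points :: "nat \<Rightarrow> (nat \<times> nat) set" where
  "boundary_points n = {(i, j). i \<le> n + 1 \<and> j \<le> n + 1 \<and> (i \<in> {0, n + 1} \<or> j \<in> {0, n + 1})}"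

text \<open>
  An odd \<open>i = 2 * a - 1\<close> is the midpoint of column \<open>a = i div 2 + 1\<close>; an even interior
  \<open>i\<close> separates column \<open>i div 2\<close> (left) from column \<open>i div 2 + 1\<close> (right).  So the width
  called \<open>h\<^sub>a\<close> is \<open>hx (i div 2 + 1)\<close> in both cases, and \<open>h\<^bsub>a-1\<^esub>\<close> (here \<open>ha'\<close>) is \<open>hx (i div 2)\<close>;
  likewise for rows.  At every even interior index \<open>i \<ge> 2\<close>, so \<open>i - 2\<close> does not truncate.
\<close>

definition Lbar :: "nat \<Rightarrow> (nat \<Rightarrow> real) \<Rightarrow> (nat \<Rightarrow> real) \<Rightarrow>
    (nat \<Rightarrow> nat \<Rightarrow> real) \<Rightarrow> nat \<Rightarrow> nat \<Rightarrow> real" where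
  "Lbar n hx hy u i j =
    (let ha = hx (i div 2 + 1); ha' = hx (i div 2);
         hb = hy (j div 2 + 1); hb' = hy (j div 2)
     in
     if (i, j) \<in> boundary_points n then u i j
     else if odd i \<and> odd j then
       (2 * ha^2 + 2 * hb^2) / (ha^2 * hb^2) * u i j
       - (u (i+1) j + u (i-1) j) / ha^2
       - (u i (j+1) + u i (j-1)) / hb^2
     else if even i \<and> odd j then
       (7 * hb^2 + 4 * ha * ha') / (2 * ha * ha' * hb^2) * u i j
       - 4 * u (i+1) j / (ha * (ha + ha'))
       - 4 * u (i-1) j / (ha' * (ha + ha'))
       - (u i (j+1) + u i (j-1)) / hb^2
       + u (i+2) j / (2 * ha * (ha + ha'))
       + u (i-2) j / (2 * ha' * (ha + ha'))
     else if odd i \<and> even j then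
       (7 * ha^2 + 4 * hb * hb') / (2 * hb * hb' * ha^2) * u i j
       - 4 * u i (j+1) / (hb * (hb + hb'))
       - 4 * u i (j-1) / (hb' * (hb + hb'))
       - (u (i+1) j + u (i-1) j) / ha^2
       + u i (j+2) / (2 * hb * (hb + hb'))
       + u i (j-2) / (2 * hb' * (hb + hb'))
     else
       (7 * ha * ha' + 7 * hb * hb') / (2 * ha * ha' * hb * hb') * u i j
       - 4 * u (i+1) j / (ha * (ha + ha'))
       - 4 * u (i-1) j / (ha' * (ha + ha'))
       - 4 * u i (j+1) / (hb * (hb + hb'))
       - 4 * u i (j-1) / (hb' * (hb + hb'))
       + u (i+2) j / (2 * ha * (ha + ha'))
       + u (i-2) j / (2 * ha' * (ha + ha'))
       + u i (j+2) / (2 * hb * (hb + hb'))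
       + u i (j-2) / (2 * hb' * (hb + hb')))"

text \<open>
  The matrix of the linear map \<open>Lbar n hx hy\<close>: the grid point \<open>(i, j)\<close> gets the number
  \<open>i + (n + 2) * j\<close>, and column \<open>c\<close> is the image of the \<open>c\<close>-th unit grid function.
\<close>

definition unit_grid :: "nat \<Rightarrow> nat \<Rightarrow> nat \<Rightarrow> nat \<Rightarrow> real" where
  "unit_grid n c i j = (if i = c mod (n + 2) \<and> j = c div (n + 2) then 1 else 0)"

definition Lbar_mat :: "nat \<Rightarrow> (nat \<Rightarrow> real) \<Rightarrow> (nat \<Rightarrow> real) \<Rightarrow> real mat" where
  "Lbar_mat n hx hy = mat ((n + 2)^2) ((n + 2)^2)
     (\<lambda>(r, c). Lbar n hx hy (unit_grid n c) (r mod (n + 2)) (r div (n + 2)))"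

definition grid_vec :: "nat \<Rightarrow> (nat \<Rightarrow> nat \<Rightarrow> real) \<Rightarrow> real vec" where
  "grid_vec n u = vec ((n + 2)^2) (\<lambda>r. u (r mod (n + 2)) (r div (n + 2)))"

text \<open>On matrices of equal dimensions \<open>\<le>\<close> is the entrywise order.\<close>

definition monotone_mat :: "real mat \<Rightarrow> bool" where
  "monotone_mat A \<longleftrightarrow> invertible_mat A \<and>
     (\<forall>B. inverts_mat A B \<and> inverts_mat B A \<longrightarrow> 0\<^sub>m (dim_row B) (dim_col B) \<le> B)"

lemma Lbar_sum:
  assumes "finite S"
  shows "Lbar n hx hy (\<lambda>i j. \<Sum>c\<in>S. v c * e c i j) i j = (\<Sum>c\<in>S. Lbar n hx hy (e c) i j * v c)"
proof -
  have lin: "Lbar n hx hy (\<lambda>i j. a * f i j + g i j) i j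
      = Lbar n hx hy f i j * a + Lbar n hx hy g i j" for a f g
    unfolding Lbar_def Let_def
    by (simp add: algebra_simps add_divide_distrib diff_divide_distrib)
  have zero: "Lbar n hx hy (\<lambda>i j. 0) i j = 0"
    by (simp add: Lbar_def Let_def)
  show ?thesis
    using assms by (induction S rule: finite_induct) (simp_all add: lin zero)
qed

lemma Lbar_cong:
  assumes "odd n" "i \<le> n + 1" "j \<le> n + 1"
    and eq: "\<And>i j. i \<le> n + 1 \<Longrightarrow> j \<le> n + 1 \<Longrightarrow> u i j = v i j"
  shows "Lbar n hx hy u i j = Lbar n hx hy v i j"
proof (cases "(i, j) \<in> boundary_points n")
  case True
  then show ?thesis using assms by (simp add: Lbar_def)
next
  case False
  then have "i \<le> n" "j \<le> n" using assms by (auto simp: boundary_points_def)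
  moreover have "i + 2 \<le> n + 1" if "even i" using that \<open>odd n\<close> \<open>i \<le> n\<close> by (cases "i = n") auto
  moreover have "j + 2 \<le> n + 1" if "even j" using that \<open>odd n\<close> \<open>j \<le> n\<close> by (cases "j = n") auto
  ultimately show ?thesis using False by (simp add: Lbar_def Let_def eq)
qed

lemma Lbar_mat_mult_grid_vec:
  assumes "odd n"
  shows "Lbar_mat n hx hy *\<^sub>v grid_vec n u = grid_vec n (Lbar n hx hy u)"
proof (intro eq_vecI)
  fix r assume "r < dim_vec (grid_vec n (Lbar n hx hy u))"
  then have r: "r < (n + 2)^2" by (simp add: grid_vec_def)
  let ?i = "r mod (n + 2)" and ?j = "r div (n + 2)"
  let ?S = "{0..<(n + 2)^2}" and ?v = "\<lambda>c. u (c mod (n + 2)) (c div (n + 2))"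
  have "?j < n + 2" using r by (simp add: power2_eq_square less_mult_imp_div_less)
  then have ij: "?i \<le> n + 1" "?j \<le> n + 1"
    using mod_less_divisor[of "n + 2" r] by linarith+
  have "(\<Sum>c\<in>?S. ?v c * unit_grid n c i j) = u i j" if "i \<le> n + 1" "j \<le> n + 1" for i j
  proof -
    let ?c = "i + (n + 2) * j"
    have c: "?c mod (n + 2) = i" "?c div (n + 2) = j"
      using that mod_mult_self2[of i "n + 2" j] div_mult_self2[of "n + 2" i j]
      by (simp_all del: mod_mult_self2 div_mult_self2)
    have "(n + 2) * j + (n + 2) \<le> (n + 2) * (n + 2)"
      using mult_le_mono2[of "Suc j" "n + 2" "n + 2"] that by simp
    then have mem: "?c \<in> ?S" using that by (simp add: power2_eq_square)
    have ug: "unit_grid n c i j = (if c = ?c then 1 else 0)" for c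
    proof -
      have "c = ?c" if "i = c mod (n + 2)" "j = c div (n + 2)"
        using that by (metis mod_mult_div_eq)
      then show ?thesis using c by (auto simp: unit_grid_def)
    qed
    have "(\<Sum>c\<in>?S. ?v c * unit_grid n c i j) = (\<Sum>c\<in>?S. if c = ?c then ?v c else 0)"
      by (intro sum.cong) (simp_all add: ug)
    also have "\<dots> = ?v ?c" using mem by (simp only: sum.delta finite_atLeastLessThan if_True)
    finally show ?thesis using c by simp
  qed
  then have "Lbar n hx hy u ?i ?j
      = Lbar n hx hy (\<lambda>i j. \<Sum>c\<in>?S. ?v c * unit_grid n c i j) ?i ?j"
    by (intro Lbar_cong[OF assms ij]) simp
  also have "\<dots> = (\<Sum>c\<in>?S. Lbar n hx hy (unit_grid n c) ?i ?j * ?v c)"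
    by (rule Lbar_sum) simp
  finally show "(Lbar_mat n hx hy *\<^sub>v grid_vec n u) $ r = grid_vec n (Lbar n hx hy u) $ r"
    using r by (simp add: Lbar_mat_def grid_vec_def scalar_prod_def)
qed (simp_all add: Lbar_mat_def grid_vec_def)

end

theory Submission
  imports Defs "Jordan_Normal_Form.Determinant"
begin

text \<open>
  Why the scheme is monotone.  Away from the boundary the operator is a sum of two
  one-dimensional operators, one in each direction, and the only thing that prevents it from
  having the sign pattern of an M-matrix are the positive weights at distance two from grid
  lines with even index.  In every such stencil the near value is weighted eight times as
  strongly as the far value behind it, so the far values do no harm as soon as the near value
  is at least one eighth of the far one (\<open>dir_op_le_diag_even\<close>).

  Let \<open>v \<ge> 0\<close> be a grid function with \<open>L v \<ge> 0\<close> at the interior points.  A midpoint stencil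
  has no far values, so solving the inequality \<open>L v \<ge> 0\<close> for the midpoint value bounds the
  midpoint from below by a multiple of each of its neighbours
  (\<open>midpoint_dominates_neighbours\<close>).  The multiple is one eighth or better
  by the aspect ratio conditions: the constant \<open>sqrt (1 / 3)\<close> is what a cell centre
  needs in order to control the centres of its edges, and the constant \<open>7 / 12\<close> is what an edge
  centre needs in order to control its end points.  The argument therefore climbs from cell
  centres to edge centres to knots, each kind of point making the far values harmless for the
  next kind.  The outcome is \<open>L v \<le> d v\<close> at every interior point, where \<open>d > 0\<close> is the diagonal
  entry (\<open>split_op_le_diag\<close>).  Consequently \<open>v \<ge> 0\<close> and \<open>L v > 0\<close> imply \<open>v > 0\<close>.

  To remove the assumption \<open>v \<ge> 0\<close>, compare with a barrier.  The scheme is exact on quadratic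
  polynomials, so a positive function \<open>w\<close> of the form \<open>const - x\<^sup>2\<close> satisfies \<open>L w = 2\<close> in the
  interior.  If \<open>L u \<ge> 0\<close> but \<open>u\<close> takes a negative value, let \<open>t < 0\<close> be the minimum of \<open>u / w\<close>;
  then \<open>v = u - t w\<close> is nonnegative, has \<open>L v > 0\<close> and vanishes somewhere, a contradiction
  (\<open>nonneg_of_Lbar_nonneg\<close>).  A square matrix that reflects nonnegativity in this way is
  injective, hence invertible, and the columns of its inverse are nonnegative.  The discrete
  maximum principle is the same comparison applied to a constant minus \<open>u\<close>.
\<close>

section \<open>Splitting the scheme into one-dimensional stencils\<close>

text \<open>
  The distance between the grid lines \<open>i\<close> and \<open>i + 1\<close>.  Measuring by grid lines instead of by
  cells makes the two half-widths at the line \<open>i\<close> always \<open>gap h (i - 1)\<close> and \<open>gap h i\<close>,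
  whatever the parity of \<open>i\<close>.
\<close>

definition gap :: "(nat \<Rightarrow> real) \<Rightarrow> nat \<Rightarrow> real" where
  "gap h i = h (i div 2 + 1)"

text \<open>
  The scheme for \<open>- u''\<close> in one variable: the three-point stencil at the midpoint of a cell, and
  a five-point stencil at a point shared by two cells.  The latter groups each near value with
  the far value behind it.
\<close>

definition dir_op :: "(nat \<Rightarrow> real) \<Rightarrow> (nat \<Rightarrow> real) \<Rightarrow> nat \<Rightarrow> real" where
  "dir_op h f i =
    (let a = gap h i; a' = gap h (i - 1) in
     if odd i then (2 * f i - f (i+1) - f (i-1)) / a^2
     else 7 / (2 * (a * a')) * f i
        - (8 * f (i+1) - f (i+2)) / (2 * a * (a + a'))
        - (8 * f (i-1) - f (i-2)) / (2 * a' * (a + a')))"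

definition dir_diag :: "(nat \<Rightarrow> real) \<Rightarrow> nat \<Rightarrow> real" where
  "dir_diag h i = (if odd i then 2 / (gap h i)^2 else 7 / (2 * (gap h i * gap h (i - 1))))"

definition split_op :: "(nat \<Rightarrow> real) \<Rightarrow> (nat \<Rightarrow> real) \<Rightarrow> (nat \<Rightarrow> nat \<Rightarrow> real) \<Rightarrow> nat \<Rightarrow> nat \<Rightarrow> real" where
  "split_op h k v i j = dir_op h (\<lambda>i. v i j) i + dir_op k (v i) j"

lemma split_op_swap: "split_op h k v i j = split_op k h (\<lambda>i j. v j i) j i"
  by (simp add: split_op_def)

lemma gap_odd: "odd i \<Longrightarrow> gap h (i - 1) = gap h i"
  by (auto simp: gap_def elim!: oddE)

lemma gap_pred: "even i \<Longrightarrow> i \<ge> 1 \<Longrightarrow> gap h (i - 1) = h (i div 2)"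
  proof -
  assume "even i" "i \<ge> 1"
  then have "(i - 1) div 2 + 1 = i div 2" by presburger
  then show ?thesis by (simp add: gap_def)
qed

lemma Lbar_boundary: "(i, j) \<in> boundary_points n \<Longrightarrow> Lbar n hx hy u i j = u i j"
  by (simp add: Lbar_def)

text \<open>
  The diagonal entries of the two-dimensional scheme are the sums of those of the
  one-dimensional stencils; they are separated here by partial fractions.
\<close>

lemma Lbar_interior:
  assumes pos: "\<And>i. i \<le> n \<Longrightarrow> 0 < gap hx i" "\<And>j. j \<le> n \<Longrightarrow> 0 < gap hy j"
    and ij: "i \<in> {1..n}" "j \<in> {1..n}"
  shows "Lbar n hx hy u i j = split_op hx hy u i j"
proof -
  have nb: "(i, j) \<notin> boundary_points n"
    using ij by (auto simp: boundary_points_def)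
  have g: "0 < gap hx i" "0 < gap hx (i-1)" "0 < gap hy j" "0 < gap hy (j-1)"
    using ij by (auto intro!: pos)
  have hxi: "hx (i div 2 + 1) = gap hx i" and hyj: "hy (j div 2 + 1) = gap hy j"
    by (simp_all add: gap_def)
  have hxi': "even i \<Longrightarrow> hx (i div 2) = gap hx (i - 1)"
    and hyj': "even j \<Longrightarrow> hy (j div 2) = gap hy (j - 1)"
    using ij gap_pred by auto
  have side: "(8 * x - y) / (2 * a * s) = 4 * x / (a * s) - y / (2 * a * s)" for x y a s :: real
    by (simp add: diff_divide_distrib)
  have knot: "(7 * a * a' + 7 * b * b') / (2 * a * a' * b * b') = 7 / (2 * (a * a')) + 7 / (2 * (b * b'))"
    if "0 < a" "0 < a'" "0 < b" "0 < b'" for a a' b b' :: real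
    using that by (simp add: field_simps)
  have edge: "(7 * b^2 + 4 * a * a') / (2 * a * a' * b^2) = 7 / (2 * (a * a')) + 2 / b^2"
    if "0 < a" "0 < a'" "0 < b" for a a' b :: real
    using that by (simp add: field_simps)
  have cell: "(2 * a^2 + 2 * b^2) / (a^2 * b^2) = 2 / a^2 + 2 / b^2"
    if "0 < a" "0 < b" for a b :: real
    using that by (simp add: field_simps)
  have mid: "(2 * x - y - z) / c = 2 / c * x - (y + z) / c" for x y z c :: real
    by (simp add: diff_divide_distrib add_divide_distrib)
  note defs = Lbar_def Let_def split_op_def dir_op_def hxi hyj side mid
  show ?thesis
  proof (cases "even i"; cases "even j")
    assume p: "even i" "even j"
    show ?thesis
      unfolding defs hxi'[OF p(1)] hyj'[OF p(2)] knot[OF g] using p nb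
      by (simp add: distrib_right del: One_nat_def)
  next
    assume p: "even i" "odd j"
    show ?thesis
      unfolding defs hxi'[OF p(1)] edge[OF g(1,2,3)] using p nb
      by (simp add: distrib_right del: One_nat_def)
  next
    assume p: "odd i" "even j"
    show ?thesis
      unfolding defs hyj'[OF p(2)] edge[OF g(3,4,1)] using p nb
      by (simp add: distrib_right del: One_nat_def)
  next
    assume p: "odd i" "odd j"
    show ?thesis
      unfolding defs cell[OF g(1,3)] using p nb
      by (simp add: distrib_right del: One_nat_def)
  qed
qed

section \<open>Exactness on quadratic polynomials\<close>

lemma dir_op_linear: "dir_op h (\<lambda>k. s * f k + t * g k) i = s * dir_op h f i + t * dir_op h g i"
  by (simp add: dir_op_def Let_def algebra_simps diff_divide_distrib add_divide_distrib)

lemma dir_op_const: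
  assumes "0 < gap h i" "0 < gap h (i - 1)"
  shows "dir_op h (\<lambda>_. c) i = 0"
proof -
  define a a' where "a = gap h i" and "a' = gap h (i - 1)"
  have pos: "0 < a" "0 < a'" using assms by (simp_all add: a_def a'_def)
  have "7 / (2 * (a * a')) = 7 / (2 * a * (a + a')) + 7 / (2 * a' * (a + a'))"
    using pos by (simp add: divide_simps)
  then have "7 / (2 * (a * a')) * c = 7 * c / (2 * a * (a + a')) + 7 * c / (2 * a' * (a + a'))"
    by (simp add: distrib_right)
  then show ?thesis
    unfolding dir_op_def Let_def a_def[symmetric] a'_def[symmetric] by simp
qed

definition node :: "(nat \<Rightarrow> real) \<Rightarrow> nat \<Rightarrow> real" where
  "node h i = (\<Sum>k<i. gap h k)"

text \<open>
  The stencils come from quadratic elements and so differentiate \<open>x\<^sup>2\<close> exactly.  Subtracting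
  \<open>x\<^sup>2\<close> from a constant therefore gives a barrier with a strictly positive image.
\<close>

lemma dir_op_node_square:
  assumes "1 \<le> i" and pos: "\<And>k. k \<le> i \<Longrightarrow> 0 < gap h k"
  shows "dir_op h (\<lambda>k. (node h k)^2) i = - 2"
proof -
  define a a' x where "a = gap h i" and "a' = gap h (i - 1)" and "x = node h i"
  have a: "0 < a" "0 < a'" using pos by (simp_all add: a_def a'_def)
  have right: "node h (i + 1) = x + a"
    by (simp add: node_def x_def a_def)
  have left: "node h (i - 1) = x - a'"
    using \<open>1 \<le> i\<close> by (cases i) (simp_all add: node_def x_def a'_def)
  show ?thesis
  proof (cases "odd i")
    case True
    then have "a' = a" unfolding a_def a'_def by (rule gap_odd)
    then show ?thesis
      using True a unfolding dir_op_def Let_def right left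
      by (simp flip: a_def a'_def x_def) (simp add: field_simps power2_eq_square)
  next
    case False
    then have "2 \<le> i" using \<open>1 \<le> i\<close> by (cases "i = 1") auto
    then obtain l where l: "i = Suc (Suc l)" "even l"
      using False by (metis add_2_eq_Suc even_Suc le_Suc_ex)
    have "gap h (Suc i) = a" "gap h l = a'"
      using l gap_odd[of "Suc i" h] gap_odd[of "Suc l" h] by (simp_all add: a_def a'_def)
    then have right2: "node h (i + 2) = x + 2 * a" and left2: "node h (i - 2) = x - 2 * a'"
      using l by (simp_all add: node_def x_def a_def a'_def)
    have "8 * (x + a)^2 - (x + 2 * a)^2 = 7 * x^2 + 2 * a * (6 * x + 2 * a)"
      "8 * (x - a')^2 - (x - 2 * a')^2 = 7 * x^2 + 2 * a' * (2 * a' - 6 * x)"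
      by (simp_all add: power2_eq_square algebra_simps)
    then have "dir_op h (\<lambda>k. (node h k)^2) i = 7 / (2 * (a * a')) * x^2
        - (7 * x^2 + 2 * a * (6 * x + 2 * a)) / (2 * a * (a + a'))
        - (7 * x^2 + 2 * a' * (2 * a' - 6 * x)) / (2 * a' * (a + a'))"
      using False unfolding dir_op_def Let_def right left right2 left2
        a_def[symmetric] a'_def[symmetric] x_def[symmetric]
      by simp
    also have "\<dots> = dir_op h (\<lambda>_. x^2) i - (6 * x + 2 * a) / (a + a') - (2 * a' - 6 * x) / (a + a')"
      using False a unfolding dir_op_def Let_def a_def[symmetric] a'_def[symmetric]
      by (simp add: add_divide_distrib)
    also have "dir_op h (\<lambda>_. x^2) i = 0"
      using a by (intro dir_op_const) (simp_all add: a_def a'_def)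
    also have "0 - (6 * x + 2 * a) / (a + a') - (2 * a' - 6 * x) / (a + a') = - 2"
      using a by (simp add: divide_simps)
    finally show ?thesis .
  qed
qed

section \<open>Bounding the stencils by their diagonal entries\<close>

lemma dir_op_le_diag_odd:
  assumes "odd i" "0 \<le> f (i + 1)" "0 \<le> f (i - 1)"
  shows "dir_op h f i \<le> dir_diag h i * f i"
proof -
  have "(2 * f i - f (i + 1) - f (i - 1)) / (gap h i)^2 \<le> 2 * f i / (gap h i)^2"
    using assms by (intro divide_right_mono) simp_all
  then show ?thesis using assms(1) by (simp add: dir_op_def dir_diag_def)
qed

text \<open>
  The ratio of the weights of a near and a far value is 8, so this is where the factor 8 of the
  whole argument comes from.
\<close>

lemma dir_op_le_diag_even:
  assumes "even i" "0 < gap h i" "0 < gap h (i - 1)"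
    and "f (i + 2) \<le> 8 * f (i + 1)" "f (i - 2) \<le> 8 * f (i - 1)"
  shows "dir_op h f i \<le> dir_diag h i * f i"
proof -
  have "0 \<le> (8 * f (i + 1) - f (i + 2)) / (2 * gap h i * (gap h i + gap h (i - 1)))"
    "0 \<le> (8 * f (i - 1) - f (i - 2)) / (2 * gap h (i - 1) * (gap h i + gap h (i - 1)))"
    using assms by (intro divide_nonneg_pos; simp)+
  then show ?thesis
    using \<open>even i\<close> by (simp add: dir_op_def dir_diag_def Let_def)
qed

text \<open>
  Here \<open>q\<close> is the contribution of the other direction to the operator, already bounded by its
  diagonal part with coefficient \<open>d\<close>.  Multiplying the inequality by the squared half-width
  leaves \<open>f (i + 1) + f (i - 1) \<le> (2 + d (gap h i)\<^sup>2) f i\<close>, and the bound 6 on \<open>d (gap h i)\<^sup>2\<close>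
  turns the right-hand factor into 8.
\<close>

lemma midpoint_dominates_neighbours:
  assumes "odd i" "0 < gap h i" and super: "0 \<le> dir_op h f i + q" and q: "q \<le> d * f i"
    and d: "d * (gap h i)^2 \<le> 6" and f: "0 \<le> f i" "0 \<le> f (i + 1)" "0 \<le> f (i - 1)"
  shows "f (i + 1) \<le> 8 * f i" "f (i - 1) \<le> 8 * f i"
proof -
  let ?g = "(gap h i)^2"
  have "0 \<le> ((2 * f i - f (i + 1) - f (i - 1)) / ?g + d * f i) * ?g"
    using super q \<open>odd i\<close> by (intro mult_nonneg_nonneg) (simp_all add: dir_op_def Let_def)
  also have "\<dots> = 2 * f i - f (i + 1) - f (i - 1) + (d * ?g) * f i"
    using \<open>0 < gap h i\<close> by (simp add: field_simps)
  finally have "0 \<le> 2 * f i - f (i + 1) - f (i - 1) + (d * ?g) * f i" .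
  moreover have "(d * ?g) * f i \<le> 6 * f i"
    using d f by (intro mult_right_mono)
  ultimately show "f (i + 1) \<le> 8 * f i" "f (i - 1) \<le> 8 * f i"
    using f by simp_all
qed

text \<open>
  The condition that makes every midpoint dominate its neighbours.  For odd \<open>j\<close> the first
  inequality compares a half-width with a half-height of one cell (the constant \<open>1 / 3\<close>), for
  even \<open>j\<close> with the product of two adjacent half-heights (the constant \<open>7 / 12\<close>).  The condition
  is symmetric in the two directions, so each lemma on one direction yields its mirror image.
\<close>

locale balanced_grid =
  fixes n :: nat and h k :: "nat \<Rightarrow> real"
  assumes odd_n: "odd n"
    and gap_pos: "\<And>i. i \<le> n \<Longrightarrow> 0 < gap h i" "\<And>j. j \<le> n \<Longrightarrow> 0 < gap k j"
    and balance_x: "\<And>i j. i \<in> {1..n} \<Longrightarrow> j \<in> {1..n} \<Longrightarrow> odd i \<Longrightarrow> dir_diag k j * (gap h i)^2 \<le> 6"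
    and balance_y: "\<And>i j. i \<in> {1..n} \<Longrightarrow> j \<in> {1..n} \<Longrightarrow> odd j \<Longrightarrow> dir_diag h i * (gap k j)^2 \<le> 6"

lemma (in balanced_grid) transposed_grid: "balanced_grid n k h"
  by unfold_locales (use odd_n gap_pos balance_x balance_y in auto)

locale supersolution = balanced_grid +
  fixes v :: "nat \<Rightarrow> nat \<Rightarrow> real"
  assumes nonneg: "\<And>i j. i \<le> n + 1 \<Longrightarrow> j \<le> n + 1 \<Longrightarrow> 0 \<le> v i j"
    and super: "\<And>i j. i \<in> {1..n} \<Longrightarrow> j \<in> {1..n} \<Longrightarrow> 0 \<le> split_op h k v i j"
begin

lemma transposed: "supersolution n k h (\<lambda>i j. v j i)"
proof -
  interpret t: balanced_grid n k h by (rule transposed_grid)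
  show ?thesis
    by unfold_locales (use nonneg super in \<open>auto simp: split_op_swap[of k h]\<close>)
qed

lemma x_neighbours_le:
  assumes "i \<in> {1..n}" "j \<in> {1..n}" "odd i"
    and "dir_op k (v i) j \<le> dir_diag k j * v i j"
  shows "v (i + 1) j \<le> 8 * v i j" "v (i - 1) j \<le> 8 * v i j"
  using assms super[of i j] gap_pos(1)[of i] balance_x[of i j]
    nonneg[of i j] nonneg[of "i + 1" j] nonneg[of "i - 1" j]
    midpoint_dominates_neighbours[of i h "\<lambda>i. v i j" "dir_op k (v i) j" "dir_diag k j"]
  by (auto simp: split_op_def)

text \<open>
  At an even \<open>i\<close> the near points \<open>i - 1\<close> and \<open>i + 1\<close> are odd, and they dominate the far points
  as soon as the other direction is under control there.
\<close>

lemma x_op_le_diag_step: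
  assumes ij: "i \<in> {1..n}" "j \<in> {1..n}"
    and y_bound: "\<And>i. i \<in> {1..n} \<Longrightarrow> odd i \<Longrightarrow> dir_op k (v i) j \<le> dir_diag k j * v i j"
  shows "dir_op h (\<lambda>i. v i j) i \<le> dir_diag h i * v i j"
proof (cases "odd i")
  case True
  then show ?thesis using ij by (intro dir_op_le_diag_odd nonneg) auto
next
  case False
  have "i \<noteq> n" "i \<noteq> 1" using False odd_n by auto
  then have i: "i - 1 \<in> {1..n}" "i + 1 \<in> {1..n}" "odd (i - 1)" "odd (i + 1)"
    using ij False by auto
  show ?thesis
  proof (rule dir_op_le_diag_even)
    show "v (i + 2) j \<le> 8 * v (i + 1) j"
      using x_neighbours_le(1)[OF i(2) ij(2) i(4) y_bound[OF i(2,4)]] by simp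
    show "v (i - 2) j \<le> 8 * v (i - 1) j"
      using x_neighbours_le(2)[OF i(1) ij(2) i(3) y_bound[OF i(1,3)]] by (simp add: numeral_2_eq_2)
  qed (use False ij in \<open>auto intro: gap_pos\<close>)
qed

text \<open>
  From cell centres to edge centres: on a row of midpoints the \<open>y\<close>-stencil has no far values.
\<close>

lemma x_op_le_diag_odd:
  assumes "i \<in> {1..n}" "j \<in> {1..n}" "odd j"
  shows "dir_op h (\<lambda>i. v i j) i \<le> dir_diag h i * v i j"
proof (rule x_op_le_diag_step)
  fix i assume "i \<in> {1..n}"
  then show "dir_op k (v i) j \<le> dir_diag k j * v i j"
    using assms by (intro dir_op_le_diag_odd nonneg) auto
qed (use assms in auto)

text \<open>
  From edge centres to knots: for odd \<open>i\<close> and arbitrary \<open>j\<close> the bound in the \<open>y\<close>-direction is the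
  mirror image of the preceding lemma.
\<close>

lemma x_op_le_diag:
  assumes "i \<in> {1..n}" "j \<in> {1..n}"
  shows "dir_op h (\<lambda>i. v i j) i \<le> dir_diag h i * v i j"
proof (rule x_op_le_diag_step)
  interpret t: supersolution n k h "\<lambda>i j. v j i" by (rule transposed)
  fix i assume "i \<in> {1..n}" "odd i"
  then show "dir_op k (v i) j \<le> dir_diag k j * v i j"
    using t.x_op_le_diag_odd assms by simp
qed (use assms in auto)

lemma split_op_le_diag:
  assumes "i \<in> {1..n}" "j \<in> {1..n}"
  shows "split_op h k v i j \<le> (dir_diag h i + dir_diag k j) * v i j"
proof -
  interpret t: supersolution n k h "\<lambda>i j. v j i" by (rule transposed)
  show ?thesis
    using x_op_le_diag[OF assms] t.x_op_le_diag[OF assms(2,1)] 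
    by (simp add: split_op_def distrib_right)
qed

end

section \<open>Comparison and maximum principles\<close>

context balanced_grid
begin

lemma Lbar_eq_split_op:
  "i \<in> {1..n} \<Longrightarrow> j \<in> {1..n} \<Longrightarrow> Lbar n h k u i j = split_op h k u i j"
  by (rule Lbar_interior) (use gap_pos in auto)

lemma positive_of_Lbar_positive:
  assumes nonneg: "\<And>i j. i \<le> n + 1 \<Longrightarrow> j \<le> n + 1 \<Longrightarrow> 0 \<le> v i j"
    and Lpos: "\<And>i j. i \<le> n + 1 \<Longrightarrow> j \<le> n + 1 \<Longrightarrow> 0 < Lbar n h k v i j"
    and ij: "i \<le> n + 1" "j \<le> n + 1"
  shows "0 < v i j"
proof (cases "(i, j) \<in> boundary_points n")
  case True
  then show ?thesis using Lpos[OF ij] by (simp add: Lbar_boundary)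
next
  case False
  then have int: "i \<in> {1..n}" "j \<in> {1..n}"
    using ij by (auto simp: boundary_points_def)
  interpret supersolution n h k v
    using nonneg by unfold_locales (use Lpos in \<open>auto simp: less_imp_le simp flip: Lbar_eq_split_op\<close>)
  have "0 < (dir_diag h i + dir_diag k j) * v i j"
    using Lpos[OF ij] split_op_le_diag[OF int] Lbar_eq_split_op[OF int] by simp
  then show ?thesis using nonneg[OF ij] by (cases "v i j = 0") auto
qed

text \<open>The shape \<open>u i j + r * (node h i)\<^sup>2 + c\<close> is that of \<open>u\<close> minus a multiple of the barrier.\<close>

lemma Lbar_barrier_correction:
  assumes "i \<in> {1..n}" "j \<in> {1..n}"
  shows "Lbar n h k (\<lambda>i j. u i j + r * (node h i)^2 + c) i j = Lbar n h k u i j - 2 * r"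
proof -
  have g: "0 < gap h i" "0 < gap h (i - 1)" "0 < gap k j" "0 < gap k (j - 1)"
    using assms by (auto intro: gap_pos)
  have add: "dir_op h' (\<lambda>k. f k + r * g k + c) l = dir_op h' f l + r * dir_op h' g l"
    if "0 < gap h' l" "0 < gap h' (l - 1)" for h' f g l r
    using dir_op_linear[of h' 1 f r g l] dir_op_linear[of h' 1 "\<lambda>k. f k + r * g k" 1 "\<lambda>_. c" l]
      dir_op_const[OF that, of c] by simp
  have "dir_op h (\<lambda>i. (node h i)^2) i = - 2"
    using assms by (intro dir_op_node_square gap_pos) auto
  then have "dir_op h (\<lambda>i. u i j + r * (node h i)^2 + c) i = dir_op h (\<lambda>i. u i j) i - 2 * r"
    using add[OF g(1,2)] by simp
  moreover have "dir_op k (\<lambda>j. u i j + r * (node h i)^2 + c) j = dir_op k (u i) j"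
    using add[OF g(3,4), of "u i" r "\<lambda>_. (node h i)^2"] dir_op_const[OF g(3,4)] by simp
  ultimately show ?thesis
    using assms by (simp add: Lbar_eq_split_op split_op_def)
qed

theorem nonneg_of_Lbar_nonneg:
  assumes Lnonneg: "\<And>i j. i \<le> n + 1 \<Longrightarrow> j \<le> n + 1 \<Longrightarrow> 0 \<le> Lbar n h k u i j"
    and ij: "i \<le> n + 1" "j \<le> n + 1"
  shows "0 \<le> u i j"
proof (rule ccontr)
  assume "\<not> 0 \<le> u i j"
  \<comment> \<open>The constant makes the barrier at least 1 up to the last grid line.\<close>
  define w where "w i = 1 + (node h (n + 1))^2 - (node h i)^2" for i
  have w: "1 \<le> w i" if "i \<le> n + 1" for i
  proof -
    have "0 \<le> node h i"
      unfolding node_def using that gap_pos by (intro sum_nonneg) (auto intro: less_imp_le)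
    moreover have "node h i \<le> node h (n + 1)"
      unfolding node_def using that gap_pos by (intro sum_mono2) (auto intro: less_imp_le)
    ultimately show ?thesis by (simp add: w_def power_mono)
  qed
  let ?G = "{..n + 1} \<times> {..n + 1}"
  obtain p q where pq: "(p, q) \<in> ?G"
    and least: "\<And>x. x \<in> ?G \<Longrightarrow> u p q / w p \<le> (\<lambda>(i, j). u i j / w i) x"
    using ex_is_arg_min_if_finite[of ?G "\<lambda>(i, j). u i j / w i"]
    by (auto simp: is_arg_min_linorder)
  define t where "t = u p q / w p"
  have t_le: "t * w i \<le> u i j" if "i \<le> n + 1" "j \<le> n + 1" for i j
  proof -
    have "t \<le> u i j / w i" using least[of "(i, j)"] that by (simp add: t_def)
    then show ?thesis using w[of i] that by (simp add: pos_le_divide_eq)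
  qed
  have "t < 0"
  proof (rule ccontr)
    assume "\<not> t < 0"
    then have "0 \<le> t * w i" using w[of i] ij by (intro mult_nonneg_nonneg) auto
    then show False using t_le[OF ij] \<open>\<not> 0 \<le> u i j\<close> by simp
  qed
  define v where "v i j = u i j + t * (node h i)^2 + (- t * (1 + (node h (n + 1))^2))" for i j
  have v: "v i j = u i j - t * w i" for i j
    by (simp add: v_def w_def algebra_simps)
  have "0 < v p q"
  proof (rule positive_of_Lbar_positive)
    fix i j assume "i \<le> n + 1" "j \<le> n + 1"
    then show "0 \<le> v i j" using t_le by (simp add: v)
  next
    fix i j assume l: "i \<le> n + 1" "j \<le> n + 1"
    show "0 < Lbar n h k v i j"
    proof (cases "(i, j) \<in> boundary_points n")
      case True
      then have "0 \<le> u i j" using Lnonneg[OF l] by (simp add: Lbar_boundary)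
      moreover have "t * w i < 0" using \<open>t < 0\<close> w[OF l(1)] by (intro mult_neg_pos) auto
      ultimately show ?thesis using True by (simp add: Lbar_boundary v)
    next
      case False
      then have int: "i \<in> {1..n}" "j \<in> {1..n}"
        using l by (auto simp: boundary_points_def)
      have "Lbar n h k v i j = Lbar n h k u i j - 2 * t"
        unfolding v_def[abs_def] by (rule Lbar_barrier_correction[OF int])
      then show ?thesis using Lnonneg[OF l] \<open>t < 0\<close> by simp
    qed
  qed (use pq in auto)
  then show False using w[of p] pq by (simp add: v t_def)
qed

lemma Lbar_const_diff:
  assumes "i \<in> {1..n}" "j \<in> {1..n}"
  shows "Lbar n h k (\<lambda>i j. c - u i j) i j = - Lbar n h k u i j"
proof -
  have "dir_op h' (\<lambda>k. c - f k) l = - dir_op h' f l"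
    if "0 < gap h' l" "0 < gap h' (l - 1)" for h' f l
    using dir_op_linear[of h' 1 "\<lambda>_. c" "-1" f l] dir_op_const[OF that, of c] by simp
  moreover have "0 < gap h i" "0 < gap h (i - 1)" "0 < gap k j" "0 < gap k (j - 1)"
    using assms by (auto intro: gap_pos)
  ultimately show ?thesis
    using assms by (simp add: Lbar_eq_split_op split_op_def)
qed

text \<open>
  The scheme annihilates constants in the interior, so comparison applies to the difference of
  the claimed bound and \<open>u\<close>.
\<close>

theorem discrete_maximum_principle:
  assumes sub: "\<forall>i\<in>{1..n}. \<forall>j\<in>{1..n}. Lbar n h k u i j \<le> 0"
  shows "Max ((\<lambda>(i, j). u i j) ` interior_points n)
    \<le> max 0 (Max ((\<lambda>(i, j). u i j) ` boundary_points n))" (is "_ \<le> ?M")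
proof -
  have fin: "finite (boundary_points n)"
    by (rule finite_subset[of _ "{..n + 1} \<times> {..n + 1}"]) (auto simp: boundary_points_def)
  have bound: "u i j \<le> ?M" if "i \<le> n + 1" "j \<le> n + 1" for i j
  proof -
    have "0 \<le> ?M - u i j"
    proof (rule nonneg_of_Lbar_nonneg[OF _ that])
      fix i j assume l: "i \<le> n + 1" "j \<le> n + 1"
      show "0 \<le> Lbar n h k (\<lambda>i j. ?M - u i j) i j"
      proof (cases "(i, j) \<in> boundary_points n")
        case True
        then have "u i j \<le> Max ((\<lambda>(i, j). u i j) ` boundary_points n)"
          using fin by (intro Max_ge) force+
        then show ?thesis using True by (simp add: Lbar_boundary)
      next
        case False
        then have int: "i \<in> {1..n}" "j \<in> {1..n}"
          using l by (auto simp: boundary_points_def)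
        then show ?thesis using sub by (simp only: Lbar_const_diff) auto
      qed
    qed
    then show ?thesis by simp
  qed
  have "1 \<le> n" using odd_n by (cases n) auto
  then show ?thesis
    by (intro Max.boundedI) (auto simp: interior_points_def intro!: bound)
qed

end

section \<open>Monotone matrices\<close>

text \<open>
  Applied to \<open>v\<close> and \<open>- v\<close> the hypothesis makes the kernel trivial.  Column \<open>c\<close> of the inverse is
  the vector that \<open>A\<close> maps to the unit vector \<open>c\<close>, so it is nonnegative.
\<close>

lemma monotone_mat_if_nonneg_reflecting:
  fixes A :: "real mat"
  assumes A: "A \<in> carrier_mat N N"
    and reflect: "\<And>v. v \<in> carrier_vec N \<Longrightarrow> (\<And>r. r < N \<Longrightarrow> 0 \<le> (A *\<^sub>v v) $ r) \<Longrightarrow> (\<And>r. r < N \<Longrightarrow> 0 \<le> v $ r)"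
  shows "monotone_mat A"
proof -
  have "v = 0\<^sub>v N" if v: "v \<in> carrier_vec N" and Av: "A *\<^sub>v v = 0\<^sub>v N" for v
  proof -
    have "0 \<le> v $ r" if "r < N" for r
      by (rule reflect[OF v _ that]) (simp add: Av)
    moreover have "v $ r \<le> 0" if "r < N" for r
    proof -
      have "A *\<^sub>v (- 1 \<cdot>\<^sub>v v) = - 1 \<cdot>\<^sub>v 0\<^sub>v N"
        by (simp only: mult_mat_vec[OF A v] Av)
      then have "0 \<le> (A *\<^sub>v (- 1 \<cdot>\<^sub>v v)) $ s" if "s < N" for s
        using that by simp
      then have "0 \<le> (- 1 \<cdot>\<^sub>v v) $ r"
        by (rule reflect[OF smult_carrier_vec[THEN iffD2, OF v] _ that])
      then show ?thesis using v that by simp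
    qed
    ultimately show ?thesis
      using v by (intro eq_vecI) (auto intro: antisym)
  qed
  then have "det A \<noteq> 0"
    unfolding det_0_iff_vec_prod_zero[OF A] by blast
  then have unit: "A \<in> Units (ring_mat TYPE(real) N ())"
    by (rule det_non_zero_imp_unit[OF A])
  have "invertible_mat A"
  proof -
    obtain B where B: "B \<in> carrier_mat N N" "B * A = 1\<^sub>m N" "A * B = 1\<^sub>m N"
      using unit by (auto simp: Units_def ring_mat_def)
    then have "inverts_mat A B" "inverts_mat B A" using A by (simp_all add: inverts_mat_def)
    then show ?thesis using A by (auto simp: invertible_mat_def)
  qed
  moreover have "0\<^sub>m (dim_row B) (dim_col B) \<le> B" if "inverts_mat A B" "inverts_mat B A" for B
  proof -
    have AB: "A * B = 1\<^sub>m N" and BA: "B * A = 1\<^sub>m (dim_row B)"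
      using that A by (auto simp: inverts_mat_def)
    have "dim_col (A * B) = N" "dim_col (B * A) = dim_row B"
      by (simp_all only: AB BA index_one_mat)
    then have B: "B \<in> carrier_mat N N" using A by auto
    have "0 \<le> B $$ (r, c)" if "r < N" "c < N" for r c
    proof -
      have "A *\<^sub>v col B c = unit_vec N c"
        using col_mult2[OF A B that(2)] AB that by simp
      then have "0 \<le> (A *\<^sub>v col B c) $ s" if "s < N" for s
        using that \<open>c < N\<close> by simp
      moreover have "col B c \<in> carrier_vec N"
        using B that by auto
      ultimately have "0 \<le> col B c $ r"
        by (intro reflect[OF _ _ that(1)])
      then show ?thesis using B that by simp
    qed
    then show ?thesis using B by (auto simp: less_eq_mat_def)
  qed
  ultimately show ?thesis by (simp add: monotone_mat_def)
qed

lemma (in balanced_grid) monotone_Lbar_mat: "monotone_mat (Lbar_mat n h k)"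
proof (rule monotone_mat_if_nonneg_reflecting)
  show "Lbar_mat n h k \<in> carrier_mat ((n + 2)^2) ((n + 2)^2)"
    by (simp add: Lbar_mat_def)
next
  fix v :: "real vec" and r
  assume v: "v \<in> carrier_vec ((n + 2)^2)" and r: "r < (n + 2)^2"
    and Av: "\<And>r. r < (n + 2)^2 \<Longrightarrow> 0 \<le> (Lbar_mat n h k *\<^sub>v v) $ r"
  define u where "u i j = v $ (i + (n + 2) * j)" for i j
  have u: "u (r mod (n + 2)) (r div (n + 2)) = v $ r" for r
    by (simp only: u_def mod_mult_div_eq)
  then have vu: "v = grid_vec n u"
    using v by (intro eq_vecI) (simp_all add: grid_vec_def)
  have "0 \<le> u (r mod (n + 2)) (r div (n + 2))"
  proof (rule nonneg_of_Lbar_nonneg)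
    fix i j assume l: "i \<le> n + 1" "j \<le> n + 1"
    let ?c = "i + (n + 2) * j"
    have c: "?c mod (n + 2) = i" "?c div (n + 2) = j"
      using l mod_mult_self2[of i "n + 2" j] div_mult_self2[of "n + 2" i j]
      by (simp_all del: mod_mult_self2 div_mult_self2)
    have "(n + 2) * j + (n + 2) \<le> (n + 2) * (n + 2)"
      using mult_le_mono2[of "Suc j" "n + 2" "n + 2"] l by simp
    then have less: "?c < (n + 2)^2" using l by (simp add: power2_eq_square)
    have "0 \<le> grid_vec n (Lbar n h k u) $ ?c"
      using Av[OF less] by (simp only: vu Lbar_mat_mult_grid_vec[OF odd_n])
    then show "0 \<le> Lbar n h k u i j"
      using less unfolding grid_vec_def by (simp only: index_vec c)
  next
    show "r mod (n + 2) \<le> n + 1"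
      using mod_less_divisor[of "n + 2" r] by linarith
    have "r div (n + 2) < n + 2"
      using r by (simp add: power2_eq_square less_mult_imp_div_less)
    then show "r div (n + 2) \<le> n + 1" by simp
  qed
  then show "0 \<le> v $ r" by (simp only: u)
qed

section \<open>From the mesh conditions to a balanced grid\<close>

lemma dir_diag_balance:
  fixes h k :: "nat \<Rightarrow> real"
  assumes pos: "\<And>a. a \<in> {1..m} \<Longrightarrow> 0 < h a" "\<And>b. b \<in> {1..m} \<Longrightarrow> 0 < k b"
    and edge: "\<And>a b. a \<in> {1..m} \<Longrightarrow> b \<in> {2..m} \<Longrightarrow> 7 / 12 * (h a)^2 \<le> k b * k (b - 1)"
    and cell: "\<And>a b. a \<in> {1..m} \<Longrightarrow> b \<in> {1..m} \<Longrightarrow> sqrt (1 / 3) * h a \<le> k b"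
    and ij: "i \<in> {1..2 * m - 1}" "j \<in> {1..2 * m - 1}"
  shows "dir_diag k j * (gap h i)^2 \<le> 6"
proof -
  have a: "i div 2 + 1 \<in> {1..m}" and b: "j div 2 + 1 \<in> {1..m}"
    using ij by auto
  show ?thesis
  proof (cases "odd j")
    case True
    have "(sqrt (1 / 3) * gap h i)^2 \<le> (gap k j)^2"
      using cell[OF a b] pos(1)[OF a] unfolding gap_def by (intro power_mono) auto
    then have "(gap h i)^2 \<le> 3 * (gap k j)^2"
      by (simp add: power_mult_distrib real_sqrt_divide power_divide)
    then show ?thesis
      using True pos(2)[OF b] by (simp add: dir_diag_def divide_le_eq gap_def)
  next
    case False
    then have "2 \<le> j" using ij by (cases "j = 1") auto
    then have j: "j div 2 + 1 \<in> {2..m}" "j div 2 \<in> {1..m}"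
      using b by auto
    have j': "gap k (j - 1) = k (j div 2)"
      using False ij by (intro gap_pred) auto
    have "7 / 12 * (gap h i)^2 \<le> gap k j * gap k (j - 1)"
      using edge[OF a j(1)] unfolding j' by (simp add: gap_def)
    moreover have "0 < gap k j * gap k (j - 1)"
      using pos(2)[OF b] pos(2)[OF j(2)] unfolding j' by (simp add: gap_def)
    ultimately show ?thesis
      using False by (simp add: dir_diag_def divide_le_eq)
  qed
qed

theorem theorem4p1:
  fixes m n :: nat and hx hy :: "nat \<Rightarrow> real"
  assumes "rect_mesh m hx hy" and "n = 2 * m - 1"
    and "\<And>a b. a \<in> {2..m} \<Longrightarrow> b \<in> {2..m} \<Longrightarrow>
           hx a * hx (a - 1) \<ge> 7 / 12 * max ((hy b)^2) ((hy (b - 1))^2)"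
    and "\<And>a b. a \<in> {2..m} \<Longrightarrow> b \<in> {2..m} \<Longrightarrow>
           hy b * hy (b - 1) \<ge> 7 / 12 * max ((hx a)^2) ((hx (a - 1))^2)"
    and "\<And>a b. a \<in> {2..m} \<Longrightarrow> b \<in> {2..m} \<Longrightarrow>
           min (hx a) (hx (a - 1)) \<ge> sqrt (1 / 3) * max (hy b) (hy (b - 1))"
    and "\<And>a b. a \<in> {2..m} \<Longrightarrow> b \<in> {2..m} \<Longrightarrow>
           min (hy b) (hy (b - 1)) \<ge> sqrt (1 / 3) * max (hx a) (hx (a - 1))"
  shows "monotone_mat (Lbar_mat n hx hy) \<and>
    (\<forall>u :: nat \<Rightarrow> nat \<Rightarrow> real.
       (\<forall>i\<in>{1..n}. \<forall>j\<in>{1..n}. Lbar n hx hy u i j \<le> 0) \<longrightarrow>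
       Max ((\<lambda>(i, j). u i j) ` interior_points n)
         \<le> max 0 (Max ((\<lambda>(i, j). u i j) ` boundary_points n)))"
proof -
  have m: "1 \<le> m" and pos: "\<And>a. a \<in> {1..m} \<Longrightarrow> 0 < hx a" "\<And>b. b \<in> {1..m} \<Longrightarrow> 0 < hy b"
    and total: "(\<Sum>a=1..m. 2 * hx a) = 1" "(\<Sum>b=1..m. 2 * hy b) = 1"
    using assms(1) by (auto simp: rect_mesh_def)
  \<comment> \<open>If there are at least two cells in a direction, each of them belongs to an adjacent pair.\<close>
  have pair: "\<exists>b\<in>{2..m}. c = b \<or> c = b - 1" if "c \<in> {1..m}" "2 \<le> m" for c
    using that by (intro bexI[of _ "max c 2"]) (auto simp: max_def)
  have edge_x: "7 / 12 * (hx a)^2 \<le> hy b * hy (b - 1)" if "a \<in> {1..m}" "b \<in> {2..m}" for a b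
  proof -
    have "2 \<le> m" using that by auto
    with pair that obtain a' where a': "a' \<in> {2..m}" "a = a' \<or> a = a' - 1" by blast
    then have "(hx a)^2 \<le> max ((hx a')^2) ((hx (a' - 1))^2)" by auto
    then show ?thesis using assms(4)[OF a'(1) that(2)] by linarith
  qed
  have edge_y: "7 / 12 * (hy b)^2 \<le> hx a * hx (a - 1)" if "b \<in> {1..m}" "a \<in> {2..m}" for a b
  proof -
    have "2 \<le> m" using that by auto
    with pair that obtain b' where b': "b' \<in> {2..m}" "b = b' \<or> b = b' - 1" by blast
    then have "(hy b)^2 \<le> max ((hy b')^2) ((hy (b' - 1))^2)" by auto
    then show ?thesis using assms(3)[OF that(2) b'(1)] by linarith
  qed
  have cell: "sqrt (1 / 3) * hx a \<le> hy b \<and> sqrt (1 / 3) * hy b \<le> hx a"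
    if ab: "a \<in> {1..m}" "b \<in> {1..m}" for a b
  proof (cases "2 \<le> m")
    case True
    obtain a' where a': "a' \<in> {2..m}" "a = a' \<or> a = a' - 1" using pair ab True by blast
    obtain b' where b': "b' \<in> {2..m}" "b = b' \<or> b = b' - 1" using pair ab True by blast
    have "sqrt (1 / 3) * hx a \<le> sqrt (1 / 3) * max (hx a') (hx (a' - 1))"
      using a' by (intro mult_left_mono) auto
    also have "\<dots> \<le> min (hy b') (hy (b' - 1))" using assms(6) a' b' by blast
    also have "\<dots> \<le> hy b" using b' by auto
    finally have 1: "sqrt (1 / 3) * hx a \<le> hy b" .
    have "sqrt (1 / 3) * hy b \<le> sqrt (1 / 3) * max (hy b') (hy (b' - 1))"
      using b' by (intro mult_left_mono) auto
    also have "\<dots> \<le> min (hx a') (hx (a' - 1))" using assms(5) a' b' by blast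
    also have "\<dots> \<le> hx a" using a' by auto
    finally show ?thesis using 1 by simp
  next
    case False
    \<comment> \<open>The ratio conditions are vacuous for a single cell, which is the unit square.\<close>
    with m have "m = 1" by simp
    with total ab have half: "hx a = 1 / 2" "hy b = 1 / 2" by auto
    have "sqrt (1 / 3) * (1 / 2) \<le> 1 * (1 / 2)" by (intro mult_right_mono) simp_all
    then show ?thesis unfolding half by simp
  qed
  interpret balanced_grid n hx hy
  proof
    show "odd n" using m assms(2) by simp
    show "0 < gap hx i" "0 < gap hy i" if "i \<le> n" for i
      using that m assms(2) pos by (auto simp: gap_def)
    fix i j assume "i \<in> {1..n}" "j \<in> {1..n}"
    then have ij: "i \<in> {1..2 * m - 1}" "j \<in> {1..2 * m - 1}" using assms(2) by auto
    show "dir_diag hy j * (gap hx i)^2 \<le> 6"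
      using dir_diag_balance[of m hx hy, OF pos edge_x _ ij] cell by simp
    show "dir_diag hx i * (gap hy j)^2 \<le> 6"
      using dir_diag_balance[of m hy hx, OF pos(2,1) edge_y _ ij(2,1)] cell by simp
  qed
  show ?thesis
    by (intro conjI allI impI monotone_Lbar_mat discrete_maximum_principle)
qed

end
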